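(* Let $\Gamma=\{\pi_\alpha:\alpha\in\Lambda\}$, where $\Lambda$ is a connected set and the $\pi_\alpha$'s are (prior) densities on $\Theta$ for the natural parameter $\theta$ of the exponential family $f(x|\theta)=\beta(\theta)t(x)e^{-\theta r(x)}$, and let $H=\beta'/\beta$. Suppose that $$\int_\Theta |H(\theta)|\,f(x|\theta)\,d\theta$$ exists and is finite, and that $\alpha_n\to\alpha$ implies $d(\pi_{\alpha_n},\pi_\alpha)\to 0$, where $d(\pi,\pi')=\sup_{\theta\in\Theta}|\pi(\theta)-\pi'(\theta)|$. Then there exists a prior distribution $\pi\in\Gamma$ such that $\delta_{PR}=\delta_\pi$; that is, the posterior regret gamma-minimax (PRGM) estimator $$\delta_{PR}=\frac{\overline{\delta}\,H(\overline{\delta})-\underline{\delta}\,H(\underline{\delta})-\log\dfrac{\beta(\overline{\delta})}{\beta(\underline{\delta})}}{H(\overline{\delta})-H(\underline{\delta})},\qquad \underline{\delta}=\inf_{\pi\in\Gamma}\delta_\pi,\quad \overline{\delta}=\sup_{\pi\in\Gamma}\delta_\pi,$$ is Bayes.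
   Context: Setting. $X$ is a random variable whose distribution belongs to the one-parameter exponential family $\{f(x|\theta):x\in\chi\subseteq\mathbb{R},\ \theta\in\Theta\subseteq\mathbb{R}\}$ with density $f(x|\theta)=\beta(\theta)t(x)e^{-\theta r(x)}$ (with respect to Lebesgue or counting measure), where $r(x)>0$ and $\beta(\theta)t(x)>0$. The function $H=\beta'/\beta$ satisfies $H(\theta)=E_\theta[r(X)]$ and is decreasing. The loss function is the intrinsic (Kullback–Leibler) loss $L(\theta,\delta)=\log\frac{\beta(\theta)}{\beta(\delta)}+(\delta-\theta)H(\theta)$, $\theta,\delta\in\Theta$. For a prior $\pi$ with posterior $\pi(\cdot|x)$, the posterior risk of $\delta(x)$ is $r(x,\delta)=E[L(\theta,\delta(x))|x]$. It is minimized by the Bayes estimator $\delta_\pi(x)=H^{-1}\{E(H(\theta)|x)\}$. The posterior regret is $\rho(\delta_\pi,\delta)=r(x,\delta)-r(x,\delta_\pi)$, and the PRGM estimator over $\Gamma$ minimizes $\sup_{\pi\in\Gamma}\rho(\delta_\pi(x),\delta(x))$ over $\delta$. The displayed formula for it is stated under the assumption that $\underline{\delta}(x)$ and $\overline{\delta}(x)$ are finite almost everywhere.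
   Formalization: The claim is proved for each fixed observation x, so the prior π with δ_PR(x)=δ_π(x) may depend on x; a single π for all x fails, e.g. for exponential data with Gamma(2,b) priors, b in [b0,b1]. *)

theory Defs
  imports "HOL-Analysis.Analysis"
begin

text \<open>
  \<open>S\<close> is the sample space. The derivative is taken within \<open>\<Theta>\<close>, so that a closed endpoint of the
  parameter set is admitted. Strictness of the monotonicity of \<open>H\<close> is what makes \<open>H\<^sup>-\<^sup>1\<close> meaningful.
  Only the sign of the product \<open>\<beta> \<theta> * t x\<close> is prescribed, not that of the factors.
\<close>

locale exp_family =
  fixes S \<Theta> :: "real set" and M :: "real measure"
    and \<beta> \<beta>' t r :: "real \<Rightarrow> real"
    and f :: "real \<Rightarrow> real \<Rightarrow> real" and H :: "real \<Rightarrow> real"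
  assumes dominating_measure:
      "(S \<in> sets borel \<and> M = restrict_space lborel S) \<or> M = count_space S"
    and parameter_set: "\<Theta> \<in> sets borel"
    and measurable_t: "t \<in> borel_measurable M"
    and measurable_r: "r \<in> borel_measurable M"
    and r_pos: "x \<in> S \<Longrightarrow> r x > 0"
    and weight_pos: "x \<in> S \<Longrightarrow> \<theta> \<in> \<Theta> \<Longrightarrow> \<beta> \<theta> * t x > 0"
    and density_eq: "x \<in> S \<Longrightarrow> \<theta> \<in> \<Theta> \<Longrightarrow> f x \<theta> = \<beta> \<theta> * t x * exp (- \<theta> * r x)"
    and density_normalised: "\<theta> \<in> \<Theta> \<Longrightarrow> (\<integral>\<^sup>+ x. ennreal (f x \<theta>) \<partial>M) = 1"
    and deriv_\<beta>: "\<theta> \<in> \<Theta> \<Longrightarrow> (\<beta> has_real_derivative \<beta>' \<theta>) (at \<theta> within \<Theta>)"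
    and H_eq: "\<theta> \<in> \<Theta> \<Longrightarrow> H \<theta> = \<beta>' \<theta> / \<beta> \<theta>"
    and mean_exists: "\<theta> \<in> \<Theta> \<Longrightarrow> integrable M (\<lambda>x. r x * f x \<theta>)"
    and mean_eq: "\<theta> \<in> \<Theta> \<Longrightarrow> H \<theta> = (\<integral>x. r x * f x \<theta> \<partial>M)"
    and H_decreasing: "strict_antimono_on \<Theta> H"

definition intrinsic_loss :: "(real \<Rightarrow> real) \<Rightarrow> (real \<Rightarrow> real) \<Rightarrow> real \<Rightarrow> real \<Rightarrow> real" where
  "intrinsic_loss \<beta> H \<theta> \<delta> = ln (\<beta> \<theta> / \<beta> \<delta>) + (\<delta> - \<theta>) * H \<theta>"

definition prior_density :: "real set \<Rightarrow> (real \<Rightarrow> real) \<Rightarrow> bool" where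
  "prior_density \<Theta> p \<longleftrightarrow>
     set_borel_measurable lborel \<Theta> p \<and> (\<forall>\<theta>\<in>\<Theta>. p \<theta> \<ge> 0) \<and>
     (\<integral>\<^sup>+ \<theta>\<in>\<Theta>. ennreal (p \<theta>) \<partial>lborel) = 1"

text \<open>The supremum is taken in \<open>[0, \<infinity>]\<close>, since a difference of two densities may be unbounded.\<close>

definition sup_distance :: "real set \<Rightarrow> (real \<Rightarrow> real) \<Rightarrow> (real \<Rightarrow> real) \<Rightarrow> ennreal" where
  "sup_distance \<Theta> p q = (SUP \<theta>\<in>\<Theta>. ennreal \<bar>p \<theta> - q \<theta>\<bar>)"

text \<open>
  In the following, \<open>f x \<theta>\<close> is the likelihood and \<open>p\<close> a prior density on \<open>\<Theta>\<close>.
\<close>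

definition posterior_density ::
    "real set \<Rightarrow> (real \<Rightarrow> real \<Rightarrow> real) \<Rightarrow> (real \<Rightarrow> real) \<Rightarrow> real \<Rightarrow> real \<Rightarrow> real" where
  "posterior_density \<Theta> f p x \<theta> = f x \<theta> * p \<theta> / (LINT \<theta>:\<Theta>|lborel. f x \<theta> * p \<theta>)"

definition posterior_expectation ::
    "real set \<Rightarrow> (real \<Rightarrow> real \<Rightarrow> real) \<Rightarrow> (real \<Rightarrow> real) \<Rightarrow> real \<Rightarrow> (real \<Rightarrow> real) \<Rightarrow> real" where
  "posterior_expectation \<Theta> f p x g = (LINT \<theta>:\<Theta>|lborel. g \<theta> * posterior_density \<Theta> f p x \<theta>)"

text \<open>
  The first conjunct excludes the case of an infinite marginal, in which the Bochner integral in
  the denominator of the posterior density would silently be \<open>0\<close>.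
\<close>

definition has_posterior_expectation ::
    "real set \<Rightarrow> (real \<Rightarrow> real \<Rightarrow> real) \<Rightarrow> (real \<Rightarrow> real) \<Rightarrow> real \<Rightarrow> (real \<Rightarrow> real) \<Rightarrow> bool" where
  "has_posterior_expectation \<Theta> f p x g \<longleftrightarrow>
     set_integrable lborel \<Theta> (\<lambda>\<theta>. f x \<theta> * p \<theta>) \<and>
     set_integrable lborel \<Theta> (\<lambda>\<theta>. g \<theta> * (f x \<theta> * p \<theta>))"

definition bayes_estimator ::
    "real set \<Rightarrow> (real \<Rightarrow> real \<Rightarrow> real) \<Rightarrow> (real \<Rightarrow> real) \<Rightarrow> (real \<Rightarrow> real) \<Rightarrow> real \<Rightarrow> real" where
  "bayes_estimator \<Theta> f H p x = the_inv_into \<Theta> H (posterior_expectation \<Theta> f p x H)"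

text \<open>
  \<open>H\<^sup>-\<^sup>1{E(H(\<theta>) | x)}\<close> is a genuine value: the posterior expectation of \<open>H\<close> exists and lies in the
  range of \<open>H\<close>. The second part is automatic if \<open>\<Theta>\<close> is an interval; it is only needed because
  no restriction is put on the shape of \<open>\<Theta>\<close>.
\<close>

definition bayes_estimator_defined ::
    "real set \<Rightarrow> (real \<Rightarrow> real \<Rightarrow> real) \<Rightarrow> (real \<Rightarrow> real) \<Rightarrow> (real \<Rightarrow> real) \<Rightarrow> real \<Rightarrow> bool" where
  "bayes_estimator_defined \<Theta> f H p x \<longleftrightarrow>
     has_posterior_expectation \<Theta> f p x H \<and> posterior_expectation \<Theta> f p x H \<in> H ` \<Theta>"

definition posterior_risk ::
    "real set \<Rightarrow> (real \<Rightarrow> real) \<Rightarrow> (real \<Rightarrow> real) \<Rightarrow> (real \<Rightarrow> real \<Rightarrow> real) \<Rightarrow>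
     (real \<Rightarrow> real) \<Rightarrow> real \<Rightarrow> real \<Rightarrow> real" where
  "posterior_risk \<Theta> \<beta> H f p x d = posterior_expectation \<Theta> f p x (\<lambda>\<theta>. intrinsic_loss \<beta> H \<theta> d)"

definition posterior_regret ::
    "real set \<Rightarrow> (real \<Rightarrow> real) \<Rightarrow> (real \<Rightarrow> real) \<Rightarrow> (real \<Rightarrow> real \<Rightarrow> real) \<Rightarrow>
     (real \<Rightarrow> real) \<Rightarrow> real \<Rightarrow> real \<Rightarrow> real" where
  "posterior_regret \<Theta> \<beta> H f p x d =
     posterior_risk \<Theta> \<beta> H f p x d - posterior_risk \<Theta> \<beta> H f p x (bayes_estimator \<Theta> f H p x)"

text \<open>\<open>d\<close> is a posterior regret gamma-minimax estimate at the observation \<open>x\<close> over the class \<open>\<Gamma>\<close>.\<close>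

definition is_PRGM ::
    "real set \<Rightarrow> (real \<Rightarrow> real) \<Rightarrow> (real \<Rightarrow> real) \<Rightarrow> (real \<Rightarrow> real \<Rightarrow> real) \<Rightarrow>
     (real \<Rightarrow> real) set \<Rightarrow> real \<Rightarrow> real \<Rightarrow> bool" where
  "is_PRGM \<Theta> \<beta> H f \<Gamma> x d \<longleftrightarrow>
     d \<in> \<Theta> \<and>
     (\<forall>d'\<in>\<Theta>. (SUP p\<in>\<Gamma>. ereal (posterior_regret \<Theta> \<beta> H f p x d))
              \<le> (SUP p\<in>\<Gamma>. ereal (posterior_regret \<Theta> \<beta> H f p x d')))"

definition lower_bayes ::
    "real set \<Rightarrow> (real \<Rightarrow> real \<Rightarrow> real) \<Rightarrow> (real \<Rightarrow> real) \<Rightarrow> (real \<Rightarrow> real) set \<Rightarrow> real \<Rightarrow> real" where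
  "lower_bayes \<Theta> f H \<Gamma> x = (INF p\<in>\<Gamma>. bayes_estimator \<Theta> f H p x)"

definition upper_bayes ::
    "real set \<Rightarrow> (real \<Rightarrow> real \<Rightarrow> real) \<Rightarrow> (real \<Rightarrow> real) \<Rightarrow> (real \<Rightarrow> real) set \<Rightarrow> real \<Rightarrow> real" where
  "upper_bayes \<Theta> f H \<Gamma> x = (SUP p\<in>\<Gamma>. bayes_estimator \<Theta> f H p x)"

text \<open>
  For \<open>lo = hi\<close> the quotient reads \<open>0 / 0\<close>; all Bayes estimates then coincide, and their common
  value is the estimate with zero posterior regret.
\<close>

definition PRGM_formula :: "(real \<Rightarrow> real) \<Rightarrow> (real \<Rightarrow> real) \<Rightarrow> real \<Rightarrow> real \<Rightarrow> real" where
  "PRGM_formula \<beta> H lo hi =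
     (if lo = hi then lo
      else (hi * H hi - lo * H lo - ln (\<beta> hi / \<beta> lo)) / (H hi - H lo))"

definition delta_PR ::
    "real set \<Rightarrow> (real \<Rightarrow> real) \<Rightarrow> (real \<Rightarrow> real) \<Rightarrow> (real \<Rightarrow> real \<Rightarrow> real) \<Rightarrow>
     (real \<Rightarrow> real) set \<Rightarrow> real \<Rightarrow> real" where
  "delta_PR \<Theta> \<beta> H f \<Gamma> x = PRGM_formula \<beta> H (lower_bayes \<Theta> f H \<Gamma> x) (upper_bayes \<Theta> f H \<Gamma> x)"

end

theory Submission
  imports Defs
begin

text \<open>
  For \<open>\<beta> > 0\<close>, \<open>ln \<beta>\<close> is strictly concave with derivative \<open>H\<close>, and the loss \<open>L(\<theta>, \<delta>)\<close> is the height at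
  \<open>\<delta>\<close> of its tangent at \<open>\<theta>\<close> above its graph. Hence \<open>L(lo, \<cdot>)\<close> increases to the right of \<open>lo\<close>,
  \<open>L(hi, \<cdot>)\<close> decreases to the left of \<open>hi\<close>, and the two agree exactly where the tangents at \<open>lo\<close>
  and \<open>hi\<close> cross, which is the PRGM formula and lies strictly between \<open>lo\<close> and \<open>hi\<close>.
  Since \<open>E(H | x)\<close> depends continuously on the prior, it takes an interval of values on the
  connected class, and so do the Bayes estimates, because \<open>H\<close> extends to a strictly decreasing
  function on the convex hull of \<open>\<Theta>\<close>.
  Therefore every point strictly between \<open>lo\<close> and \<open>hi\<close> is a Bayes estimate. Finally the posterior
  regret of \<open>d\<close> equals \<open>L(\<delta>\<^sub>\<pi>, d)\<close>, whose supremum over the class is the larger of \<open>L(lo, d)\<close> and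
  \<open>L(hi, d)\<close>.
\<close>

section \<open>Exponential tilting of a weight\<close>

lemma integral_pos_if_not_AE_zero:
  fixes h :: "'b \<Rightarrow> real"
  assumes "integrable M h" "\<And>y. y \<in> space M \<Longrightarrow> 0 \<le> h y" "\<not> (AE y in M. h y = 0)"
  shows "0 < (\<integral>y. h y \<partial>M)"
proof -
  have nn: "AE y in M. 0 \<le> h y"
    using assms(2) by (intro AE_I2)
  show ?thesis
    using integral_nonneg_eq_0_iff_AE[OF assms(1) nn] integral_nonneg_AE[OF nn] assms(3) by linarith
qed

text \<open>The mean of \<open>r\<close> under the probability density proportional to
  \<open>w y * exp (- s * r y)\<close>. With a member of the family as \<open>w\<close>, it recovers
  the other members and also covers parameters outside \<Theta>.\<close>

definition tilted_mean :: "'b measure \<Rightarrow> ('b \<Rightarrow> real) \<Rightarrow> ('b \<Rightarrow> real) \<Rightarrow> real \<Rightarrow> real" where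
  "tilted_mean M r w s =
     (\<integral>y. r y * w y * exp (- s * r y) \<partial>M) / (\<integral>y. w y * exp (- s * r y) \<partial>M)"

text \<open>As \<open>r\<close> is positive, the factor \<open>exp (- s * r y)\<close> is at most 1
  for \<open>s \<ge> 0\<close>. For negative \<open>s\<close> it may destroy integrability, hence
  the one-sided range of the tilting results.\<close>

lemma integrable_exp_tilt:
  fixes g r :: "'b \<Rightarrow> real"
  assumes g: "integrable M g" and r: "r \<in> borel_measurable M"
    and pos: "\<And>y. y \<in> space M \<Longrightarrow> 0 < r y" and s: "0 \<le> s"
  shows "integrable M (\<lambda>y. g y * exp (- s * r y))"
proof (rule Bochner_Integration.integrable_bound[OF g])
  show "(\<lambda>y. g y * exp (- s * r y)) \<in> borel_measurable M"
    using r borel_measurable_integrable[OF g] by measurable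
  have "\<bar>g y\<bar> * exp (- (s * r y)) \<le> \<bar>g y\<bar> * 1" if "y \<in> space M" for y
    using pos[OF that] s by (intro mult_left_mono) auto
  then show "AE y in M. norm (g y * exp (- s * r y)) \<le> norm (g y)"
    by (intro AE_I2) (simp add: abs_mult)
qed

lemma continuous_on_exp_tilt:
  fixes g r :: "'b \<Rightarrow> real"
  assumes g: "integrable M g" and r: "r \<in> borel_measurable M"
    and pos: "\<And>y. y \<in> space M \<Longrightarrow> 0 < r y"
  shows "continuous_on {0..} (\<lambda>s. \<integral>y. g y * exp (- s * r y) \<partial>M)"
proof (rule continuous_on_sequentiallyI)
  fix u :: "nat \<Rightarrow> real" and s
  assume u: "\<forall>n. u n \<in> {0..}" and us: "u \<longlonglongrightarrow> s"
  have gm: "g \<in> borel_measurable M" using g by simp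
  show "(\<lambda>n. \<integral>y. g y * exp (- u n * r y) \<partial>M) \<longlonglongrightarrow> (\<integral>y. g y * exp (- s * r y) \<partial>M)"
  proof (rule integral_dominated_convergence[where w = "\<lambda>y. \<bar>g y\<bar>"])
    show "AE y in M. (\<lambda>n. g y * exp (- u n * r y)) \<longlonglongrightarrow> g y * exp (- s * r y)"
      by (intro AE_I2 tendsto_intros us)
    have "\<bar>g y\<bar> * exp (- (u n * r y)) \<le> \<bar>g y\<bar> * 1" if "y \<in> space M" for y n
      using pos[OF that] u by (intro mult_left_mono) auto
    then show "AE y in M. norm (g y * exp (- u n * r y)) \<le> \<bar>g y\<bar>" for n
      by (intro AE_I2) (simp add: abs_mult)
  qed (use g gm r in auto)
qed

locale tilting =
  fixes M :: "'b measure" and r w :: "'b \<Rightarrow> real"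
  assumes r_meas: "r \<in> borel_measurable M"
    and r_gt_0: "y \<in> space M \<Longrightarrow> 0 < r y"
    and w_pos: "y \<in> space M \<Longrightarrow> 0 < w y"
    and w_int: "integrable M w" and rw_int: "integrable M (\<lambda>y. r y * w y)"
    and M_nonzero: "\<not> (AE y in M. False)"
begin

lemma tilted_mass_pos:
  assumes "0 \<le> s" shows "0 < (\<integral>y. w y * exp (- s * r y) \<partial>M)"
proof (rule integral_pos_if_not_AE_zero)
  show "integrable M (\<lambda>y. w y * exp (- s * r y))"
    by (rule integrable_exp_tilt[OF w_int r_meas r_gt_0 assms])
  show "\<not> (AE y in M. w y * exp (- s * r y) = 0)"
  proof
    assume "AE y in M. w y * exp (- s * r y) = 0"
    then have "AE y in M. False"
      by (rule AE_mp) (use w_pos in \<open>auto intro!: AE_I2 dest!: w_pos\<close>)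
    then show False using M_nonzero by blast
  qed
qed (use w_pos in \<open>auto intro!: less_imp_le\<close>)

lemma continuous_on_tilted_mean: "continuous_on {0..} (tilted_mean M r w)"
  unfolding tilted_mean_def
  using tilted_mass_pos
  by (intro continuous_on_divide continuous_on_exp_tilt w_int rw_int r_meas r_gt_0)
     (auto simp: less_le)

text \<open>A covariance inequality: the weight at \<open>s\<close> is the weight at
  \<open>s'\<close> times \<open>exp (k * r y)\<close>, which increases with \<open>r y\<close>, so
  passing from \<open>s'\<close> to \<open>s\<close> raises the mean.\<close>

lemma tilted_mean_strict_antimono:
  assumes not_const: "\<And>m. \<not> (AE y in M. r y = m)" and s: "0 \<le> s" and ss': "s < s'"
  shows "tilted_mean M r w s' < tilted_mean M r w s"
proof -
  have s': "0 \<le> s'" using s ss' by simp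
  define m where "m = tilted_mean M r w s'"
  define k where "k = s' - s"
  have k: "k > 0" using ss' by (simp add: k_def)
  note wi = integrable_exp_tilt[OF w_int r_meas r_gt_0]
  note rwi = integrable_exp_tilt[OF rw_int r_meas r_gt_0]
  let ?A = "\<lambda>u. \<integral>y. r y * w y * exp (- u * r y) \<partial>M" and ?B = "\<lambda>u. \<integral>y. w y * exp (- u * r y) \<partial>M"
  \<comment> \<open>The two differences always have the same sign. Subtracting
    \<open>exp (k * m)\<close> costs nothing, because \<open>r y - m\<close> integrates to zero
    against the weight at \<open>s'\<close>.\<close>
  let ?h = "\<lambda>y. (r y - m) * (w y * exp (- s' * r y)) * (exp (k * r y) - exp (k * m))"
  \<comment> \<open>Absorbing \<open>exp (k * r y)\<close> into the weight at \<open>s\<close>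
    leaves only integrable tilts.\<close>
  have h_eq: "?h y = (r y * w y * exp (- s * r y) - m * (w y * exp (- s * r y)))
      - exp (k * m) * (r y * w y * exp (- s' * r y) - m * (w y * exp (- s' * r y)))" for y
  proof -
    have "exp (- s * r y) = exp (- s' * r y) * exp (k * r y)"
      by (simp add: k_def flip: exp_add) (simp add: algebra_simps)
    then show ?thesis by (simp add: algebra_simps)
  qed
  have h_int: "integrable M ?h"
    unfolding h_eq by (intro Bochner_Integration.integrable_diff integrable_mult_right wi rwi s s')
  have "0 < (\<integral>y. ?h y \<partial>M)"
  proof (rule integral_pos_if_not_AE_zero[OF h_int])
    fix y assume y: "y \<in> space M"
    have "0 \<le> (r y - m) * (exp (k * r y) - exp (k * m))"
      using k by (cases "r y \<le> m") (auto intro: mult_nonneg_nonneg mult_nonpos_nonpos)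
    then have "0 \<le> (w y * exp (- s' * r y)) * ((r y - m) * (exp (k * r y) - exp (k * m)))"
      using w_pos[OF y] by (intro mult_nonneg_nonneg[of "w y * _"]) (auto simp: less_imp_le)
    then show "0 \<le> ?h y" by (simp add: ac_simps)
  next
    show "\<not> (AE y in M. ?h y = 0)"
    proof
      assume "AE y in M. ?h y = 0"
      then have "AE y in M. r y = m"
        by (rule AE_mp) (use w_pos k in \<open>auto intro!: AE_I2 dest!: w_pos\<close>)
      then show False using not_const by blast
    qed
  qed
  also have "(\<integral>y. ?h y \<partial>M) = (?A s - m * ?B s) - exp (k * m) * (?A s' - m * ?B s')"
    unfolding h_eq using wi[OF _ s] wi[OF _ s'] rwi[OF _ s] rwi[OF _ s']
    by simp
  also have "?A s' - m * ?B s' = 0"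
    using tilted_mass_pos[OF s'] by (simp add: m_def tilted_mean_def)
  finally show ?thesis
    using tilted_mass_pos[OF s] by (simp add: m_def[symmetric]) (simp add: tilted_mean_def pos_less_divide_eq)
qed

end

section \<open>The exponential family: sign of \<beta>, behaviour of \<open>H\<close>, concavity of
  \<open>ln \<beta>\<close>\<close>

context exp_family
begin

lemma space_M: "space M = S"
  using dominating_measure by (auto simp: space_restrict_space)

lemma f_pos: "y \<in> S \<Longrightarrow> \<theta> \<in> \<Theta> \<Longrightarrow> 0 < f y \<theta>"
  using density_eq weight_pos by simp

lemma M_not_null:
  assumes "\<theta> \<in> \<Theta>" shows "\<not> (AE y in M. False)"
proof
  assume "AE y in M. False"
  then have "(\<integral>\<^sup>+ y. ennreal (f y \<theta>) \<partial>M) = (\<integral>\<^sup>+ y. 0 \<partial>M)"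
    by (intro nn_integral_cong_AE) auto
  then show False using density_normalised[OF assms] by simp
qed

lemma S_nonempty: "\<theta> \<in> \<Theta> \<Longrightarrow> S \<noteq> {}"
  using M_not_null space_M by (metis AE_I2 empty_iff)

text \<open>\<beta> may be negative, but the common factor \<open>t y\<close> of a single
  observation \<open>y\<close> forces one sign on all of \<Theta>. This is why logarithms are taken
  of ratios only.\<close>

lemma \<beta>_ratio_pos: "a \<in> \<Theta> \<Longrightarrow> b \<in> \<Theta> \<Longrightarrow> 0 < \<beta> b / \<beta> a"
proof -
  assume ab: "a \<in> \<Theta>" "b \<in> \<Theta>"
  obtain y where "y \<in> S" using S_nonempty[OF ab(1)] by blast
  then have "0 < \<beta> a * t y" "0 < \<beta> b * t y" using weight_pos ab by auto
  then show ?thesis by (auto simp: zero_less_mult_iff intro: divide_pos_pos divide_neg_neg)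
qed

lemma \<beta>_nonzero: "a \<in> \<Theta> \<Longrightarrow> \<beta> a \<noteq> 0"
  using \<beta>_ratio_pos[of a a] by auto

lemma ln_\<beta>_ratio_trans:
  assumes "a \<in> \<Theta>" "b \<in> \<Theta>" "c \<in> \<Theta>"
  shows "ln (\<beta> c / \<beta> a) = ln (\<beta> c / \<beta> b) + ln (\<beta> b / \<beta> a)"
proof -
  have "\<beta> c / \<beta> a = (\<beta> c / \<beta> b) * (\<beta> b / \<beta> a)"
    using \<beta>_nonzero[OF assms(2)] by simp
  then show ?thesis using \<beta>_ratio_pos assms by (simp only: ln_mult_pos)
qed

lemma ln_\<beta>_ratio_swap:
  assumes "a \<in> \<Theta>" "b \<in> \<Theta>"
  shows "ln (\<beta> a / \<beta> b) = - ln (\<beta> b / \<beta> a)"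
  using ln_\<beta>_ratio_trans[OF assms(1,2) assms(1)] \<beta>_nonzero[OF assms(1)] by simp

lemma f_measurable:
  assumes "\<theta> \<in> \<Theta>" shows "(\<lambda>y. f y \<theta>) \<in> borel_measurable M"
proof -
  have "(\<lambda>y. \<beta> \<theta> * t y * exp (- \<theta> * r y)) \<in> borel_measurable M"
    using measurable_t measurable_r by measurable
  then show ?thesis
    by (rule measurable_cong[THEN iffD1, rotated]) (simp add: density_eq assms space_M)
qed

lemma f_has_integral:
  assumes "\<theta> \<in> \<Theta>" shows "has_bochner_integral M (\<lambda>y. f y \<theta>) 1"
  using density_normalised[OF assms] f_pos assms
  by (intro has_bochner_integral_nn_integral f_measurable AE_I2) (auto simp: space_M less_imp_le)

lemma f_tilt:
  assumes "y \<in> S" "a \<in> \<Theta>" "b \<in> \<Theta>"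
  shows "f y b = \<beta> b / \<beta> a * (f y a * exp (- (b - a) * r y))"
proof -
  have "exp (- b * r y) = exp (- a * r y) * exp (- (b - a) * r y)"
    by (simp add: algebra_simps flip: exp_add)
  then show ?thesis using assms by (simp add: density_eq \<beta>_nonzero)
qed

lemma tilting_f:
  assumes "a \<in> \<Theta>" shows "tilting M r (\<lambda>y. f y a)"
  using measurable_r r_pos f_pos[OF _ assms] f_has_integral[OF assms] mean_exists[OF assms]
    M_not_null[OF assms]
  by unfold_locales (auto simp: space_M has_bochner_integral_iff)

text \<open>Normalisation of the density at \<open>b\<close> identifies
  \<open>\<beta> b / \<beta> a\<close> as the reciprocal of the tilted mass, and the mean of
  \<open>r\<close> at \<open>b\<close> then becomes the quotient.\<close>

lemma H_eq_tilted_mean: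
  assumes "a \<in> \<Theta>" "b \<in> \<Theta>"
  shows "H b = tilted_mean M r (\<lambda>y. f y a) (b - a)"
proof -
  let ?w = "\<lambda>y. f y a * exp (- (b - a) * r y)"
  have "1 = (\<integral>y. f y b \<partial>M)"
    using f_has_integral[OF assms(2)] by (simp add: has_bochner_integral_iff)
  also have "\<dots> = (\<integral>y. \<beta> b / \<beta> a * ?w y \<partial>M)"
    by (rule Bochner_Integration.integral_cong) (auto simp only: space_M f_tilt[OF _ assms])
  also have "\<dots> = \<beta> b / \<beta> a * (\<integral>y. ?w y \<partial>M)"
    by (rule integral_mult_right_zero)
  finally have 1: "1 = \<beta> b / \<beta> a * (\<integral>y. ?w y \<partial>M)" .
  have "H b = (\<integral>y. r y * f y b \<partial>M)" by (rule mean_eq[OF assms(2)])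
  also have "\<dots> = (\<integral>y. \<beta> b / \<beta> a * (r y * f y a * exp (- (b - a) * r y)) \<partial>M)"
    by (rule Bochner_Integration.integral_cong) (auto simp only: space_M f_tilt[OF _ assms] ac_simps)
  also have "\<dots> = \<beta> b / \<beta> a * (\<integral>y. r y * f y a * exp (- (b - a) * r y) \<partial>M)"
    by (rule integral_mult_right_zero)
  finally have 2: "H b = \<beta> b / \<beta> a * (\<integral>y. r y * f y a * exp (- (b - a) * r y) \<partial>M)" .
  have "(\<integral>y. ?w y \<partial>M) = inverse (\<beta> b / \<beta> a)"
    by (rule inverse_unique[OF 1[symmetric], symmetric])
  then show ?thesis
    unfolding tilted_mean_def 2 by (simp only: divide_inverse inverse_inverse_eq mult.commute)
qed

text \<open>A constant \<open>r\<close> would make \<open>H\<close> constant. This is the source of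
  strictness for the tilted mean and for the tangent inequality.\<close>

lemma r_not_AE_const:
  assumes "a \<in> \<Theta>" "b \<in> \<Theta>" "a \<noteq> b"
  shows "\<not> (AE y in M. r y = m)"
proof
  assume m: "AE y in M. r y = m"
  have "H \<theta> = m" if "\<theta> \<in> \<Theta>" for \<theta>
  proof -
    have "H \<theta> = (\<integral>y. r y * f y \<theta> \<partial>M)" by (rule mean_eq[OF that])
    also have "\<dots> = (\<integral>y. m * f y \<theta> \<partial>M)"
      by (rule integral_cong_AE) (use m mean_exists[OF that] f_measurable[OF that] in auto)
    also have "\<dots> = m" using f_has_integral[OF that] by (simp add: has_bochner_integral_iff)
    finally show ?thesis .
  qed
  then show False
    using H_decreasing assms by (force simp: monotone_on_def neq_iff)
qed

lemma H_strict: "a \<in> \<Theta> \<Longrightarrow> b \<in> \<Theta> \<Longrightarrow> a < b \<Longrightarrow> H b < H a"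
  using H_decreasing by (auto simp: monotone_on_def)

lemma inj_on_H: "inj_on H \<Theta>"
  by (rule linorder_inj_onI') (use H_strict in force)

lemma H_pos: "\<theta> \<in> \<Theta> \<Longrightarrow> 0 < H \<theta>"
proof -
  assume \<theta>: "\<theta> \<in> \<Theta>"
  interpret tilting M r "\<lambda>y. f y \<theta>" by (rule tilting_f[OF \<theta>])
  have "0 < (\<integral>y. r y * f y \<theta> \<partial>M)"
  proof (rule integral_pos_if_not_AE_zero[OF rw_int])
    show "\<not> (AE y in M. r y * f y \<theta> = 0)"
    proof
      assume "AE y in M. r y * f y \<theta> = 0"
      then have "AE y in M. False"
        by (rule AE_mp) (auto intro!: AE_I2 dest: w_pos r_gt_0)
      then show False using M_nonzero by blast
    qed
  qed (auto intro!: less_imp_le mult_pos_pos w_pos r_gt_0)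
  then show ?thesis using mean_eq[OF \<theta>] by simp
qed

text \<open>Tilting from \<open>a\<close> is controlled to the right of \<open>a\<close> only; for
  an interval inside \<Theta> it suffices to tilt from its left end.\<close>

lemma continuous_on_H: "a \<in> \<Theta> \<Longrightarrow> continuous_on (\<Theta> \<inter> {a..}) H"
proof -
  assume a: "a \<in> \<Theta>"
  interpret tilting M r "\<lambda>y. f y a" by (rule tilting_f[OF a])
  have "continuous_on (\<Theta> \<inter> {a..}) (\<lambda>b. tilted_mean M r (\<lambda>y. f y a) (b - a))"
    by (rule continuous_on_compose2[OF continuous_on_tilted_mean]) (auto intro!: continuous_intros)
  then show ?thesis
    by (rule continuous_on_cong[THEN iffD1, rotated -1]) (auto simp: H_eq_tilted_mean[OF a])
qed

lemma continuous_on_\<beta>: "continuous_on \<Theta> \<beta>"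
  by (rule DERIV_continuous_on[OF deriv_\<beta>])

text \<open>Outside \<open>\<Theta>\<close> the mean of the tilted density stands in for \<open>H\<close>: it is strictly decreasing on
  the convex hull of \<open>\<Theta>\<close>, so a gap in \<open>D\<close> would leave a gap in \<open>H ` D\<close>.\<close>

lemma is_interval_if_is_interval_H_image:
  assumes D: "D \<subseteq> \<Theta>" and J: "is_interval (H ` D)"
  shows "is_interval D"
  unfolding is_interval_1
proof clarify
  fix a b c assume ab: "a \<in> D" "b \<in> D" "a \<le> c" "c \<le> b"
  show "c \<in> D"
  proof (cases "c = a \<or> c = b")
    case False
    then have less: "a < c" "c < b" using ab by auto
    have a: "a \<in> \<Theta>" and b: "b \<in> \<Theta>" using ab D by auto
    interpret tilting M r "\<lambda>y. f y a" by (rule tilting_f[OF a])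
    define G where "G = (\<lambda>u. tilted_mean M r (\<lambda>y. f y a) (u - a))"
    have GH: "G u = H u" if "u \<in> \<Theta>" for u
      unfolding G_def by (rule H_eq_tilted_mean[OF a that, symmetric])
    have G_strict: "G v < G u" if "a \<le> u" "u < v" for u v
      unfolding G_def using r_not_AE_const[OF a b] less that
      by (intro tilted_mean_strict_antimono) auto
    have "G b \<le> G c" "G c \<le> G a" using G_strict less by (auto intro: less_imp_le)
    then have "G c \<in> H ` D"
      using J ab GH a b unfolding is_interval_1 by (metis imageI)
    then obtain d where d: "d \<in> D" "G c = G d" using GH D by auto
    \<comment> \<open>\<open>G\<close> is known to decrease only to the right of \<open>a\<close>,
      so \<open>d\<close> must be placed there before it can be compared with
      \<open>c\<close>.\<close>
    have "H d \<le> H a" using less G_strict[of a c] GH[OF a] d GH D by auto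
    then have "a \<le> d" using H_strict[of d a] a d(1) D by force
    then have "d = c" using G_strict[of c d] G_strict[of d c] less d(2) by force
    then show ?thesis using d by simp
  qed (use ab in auto)
qed

text \<open>Positivity of the Kullback-Leibler divergence between the densities at \<open>a\<close>
  and \<open>b\<close>: \<open>u\<close> is their ratio, and \<open>u - 1 - ln u\<close> has
  positive mean under the density at \<open>a\<close>. Since only means of \<open>r\<close> enter,
  gaps in \<Theta> do no harm.\<close>

lemma ln_\<beta>_ratio_less:
  assumes "a \<in> \<Theta>" "b \<in> \<Theta>" "a \<noteq> b"
  shows "ln (\<beta> b / \<beta> a) < (b - a) * H a"
proof -
  define R where "R = \<beta> b / \<beta> a"
  have R: "0 < R" unfolding R_def by (rule \<beta>_ratio_pos[OF assms(1,2)])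
  define u where "u = (\<lambda>y. R * exp (- (b - a) * r y))"
  have u_pos: "0 < u y" for y using R by (simp add: u_def)
  have ln_u: "ln (u y) = ln R - (b - a) * r y" for y
    using R by (simp add: u_def ln_mult_pos algebra_simps)
  let ?h = "\<lambda>y. f y b - (1 + ln R) * f y a + (b - a) * (r y * f y a)"
  have h_eq: "?h y = f y a * (u y - 1 - ln (u y))" if "y \<in> S" for y
    unfolding ln_u f_tilt[OF that assms(1,2)] by (simp add: u_def R_def algebra_simps)
  have I: "integrable M (\<lambda>y. f y a)" "(\<integral>y. f y a \<partial>M) = 1"
    "integrable M (\<lambda>y. f y b)" "(\<integral>y. f y b \<partial>M) = 1"
    using f_has_integral assms by (auto simp: has_bochner_integral_iff)
  have "0 < (\<integral>y. ?h y \<partial>M)"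
  proof (rule integral_pos_if_not_AE_zero)
    show "integrable M ?h" using I mean_exists[OF assms(1)] by auto
    show "0 \<le> ?h y" if "y \<in> space M" for y
      using that ln_le_minus_one[OF u_pos[of y]] f_pos[OF _ assms(1), of y]
      by (simp add: space_M h_eq)
    show "\<not> (AE y in M. ?h y = 0)"
    proof
      assume h0: "AE y in M. ?h y = 0"
      \<comment> \<open>Equality in \<open>ln u \<le> u - 1\<close> holds only at
        \<open>u = 1\<close>, which pins \<open>r y\<close> to one constant.\<close>
      have r_eq: "r y = ln R / (b - a)" if "y \<in> space M" "?h y = 0" for y
      proof -
        have "ln (u y) = u y - 1"
          using that h_eq[of y] f_pos[OF _ assms(1), of y] by (simp add: space_M)
        then have "u y = 1" using ln_eq_minus_one[OF u_pos] by simp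
        then have "ln R = (b - a) * r y" using ln_u[of y] by simp
        then show ?thesis using assms by simp
      qed
      have "AE y in M. r y = ln R / (b - a)"
        by (rule AE_mp[OF h0 AE_I2]) (use r_eq in blast)
      then show False using r_not_AE_const[OF assms] by blast
    qed
  qed
  also have "(\<integral>y. ?h y \<partial>M) = 1 - (1 + ln R) + (b - a) * H a"
    using I mean_exists[OF assms(1)] mean_eq[OF assms(1)] by simp
  finally show ?thesis by (simp add: R_def)
qed

lemma ln_\<beta>_ratio_le:
  assumes "a \<in> \<Theta>" "b \<in> \<Theta>"
  shows "ln (\<beta> b / \<beta> a) \<le> (b - a) * H a"
  using ln_\<beta>_ratio_less[OF assms] \<beta>_nonzero[OF assms(1)] by (cases "a = b") auto

end

section \<open>Integrals over the parameter set\<close>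

lemma set_integrable_exp_decay:
  fixes k c :: real
  assumes "0 < k" shows "set_integrable lborel {c..} (\<lambda>\<theta>. exp (- k * \<theta>))"
proof -
  have "set_integrable lebesgue {c..} (\<lambda>\<theta>. exp (- k * \<theta>))"
    by (intro nonnegative_absolutely_integrable_1 integrable_on_exp_minus_to_infinity assms) auto
  then show ?thesis unfolding set_integrable_def
    by (subst (asm) integrable_completion) auto
qed

text \<open>The difference of the integrals is at most the sup distance times the integral of
  \<open>\<bar>k\<bar>\<close>.\<close>

lemma set_integral_tendsto_sup_distance:
  fixes k :: "real \<Rightarrow> real" and p :: "nat \<Rightarrow> real \<Rightarrow> real"
  assumes k: "set_integrable lborel \<Theta> (\<lambda>\<theta>. \<bar>k \<theta>\<bar>)"
    and p: "\<And>n. set_integrable lborel \<Theta> (\<lambda>\<theta>. k \<theta> * p n \<theta>)"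
    and q: "set_integrable lborel \<Theta> (\<lambda>\<theta>. k \<theta> * q \<theta>)"
    and lim: "(\<lambda>n. sup_distance \<Theta> (p n) q) \<longlonglongrightarrow> 0"
  shows "(\<lambda>n. LINT \<theta>:\<Theta>|lborel. k \<theta> * p n \<theta>) \<longlonglongrightarrow> (LINT \<theta>:\<Theta>|lborel. k \<theta> * q \<theta>)"
proof -
  let ?d = "\<lambda>n. enn2real (sup_distance \<Theta> (p n) q)" and ?K = "LINT \<theta>:\<Theta>|lborel. \<bar>k \<theta>\<bar>"
  have "?d \<longlonglongrightarrow> 0" by (rule tendsto_enn2real) (use lim in simp_all)
  then have d0: "(\<lambda>n. ?K * ?d n) \<longlonglongrightarrow> 0" by (rule tendsto_mult_right_zero)
  \<comment> \<open>Where the distance is infinite, \<open>enn2real\<close> returns 0 and the bound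
    may fail, so it is claimed only from some index on.\<close>
  have fin: "\<forall>\<^sub>F n in sequentially. sup_distance \<Theta> (p n) q < 1"
    by (rule order_tendstoD(2)[OF lim]) simp
  have "(\<lambda>n. (LINT \<theta>:\<Theta>|lborel. k \<theta> * p n \<theta>) - (LINT \<theta>:\<Theta>|lborel. k \<theta> * q \<theta>)) \<longlonglongrightarrow> 0"
  proof (rule Lim_null_comparison[OF _ d0], rule eventually_mono[OF fin])
    fix n assume n: "sup_distance \<Theta> (p n) q < 1"
    have le: "\<bar>p n \<theta> - q \<theta>\<bar> \<le> ?d n" if "\<theta> \<in> \<Theta>" for \<theta>
    proof -
      have "ennreal \<bar>p n \<theta> - q \<theta>\<bar> \<le> sup_distance \<Theta> (p n) q"
        unfolding sup_distance_def by (rule SUP_upper[OF that])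
      then have "enn2real (ennreal \<bar>p n \<theta> - q \<theta>\<bar>) \<le> ?d n"
        using n by (intro enn2real_mono) (auto intro: less_trans)
      then show ?thesis by simp
    qed
    have "norm ((LINT \<theta>:\<Theta>|lborel. k \<theta> * p n \<theta>) - (LINT \<theta>:\<Theta>|lborel. k \<theta> * q \<theta>))
        = norm (LINT \<theta>:\<Theta>|lborel. k \<theta> * p n \<theta> - k \<theta> * q \<theta>)"
      using set_integral_diff(2)[OF p q] by simp
    also have "\<dots> \<le> (LINT \<theta>:\<Theta>|lborel. \<bar>k \<theta>\<bar> * ?d n)"
      unfolding set_lebesgue_integral_def
    proof (rule Bochner_Integration.integral_norm_bound_integral)
      show "integrable lborel (\<lambda>\<theta>. indicat_real \<Theta> \<theta> *\<^sub>R (k \<theta> * p n \<theta> - k \<theta> * q \<theta>))"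
        using set_integral_diff(1)[OF p q] by (simp add: set_integrable_def)
      show "integrable lborel (\<lambda>\<theta>. indicat_real \<Theta> \<theta> *\<^sub>R (\<bar>k \<theta>\<bar> * ?d n))"
        using set_integrable_mult_left[OF k, of "?d n"] by (simp add: set_integrable_def)
      fix \<theta> :: real
      have "\<bar>k \<theta>\<bar> * \<bar>p n \<theta> - q \<theta>\<bar> \<le> \<bar>k \<theta>\<bar> * ?d n" if "\<theta> \<in> \<Theta>"
        using le[OF that] by (rule mult_left_mono) simp
      then show "norm (indicat_real \<Theta> \<theta> *\<^sub>R (k \<theta> * p n \<theta> - k \<theta> * q \<theta>))
          \<le> indicat_real \<Theta> \<theta> *\<^sub>R (\<bar>k \<theta>\<bar> * ?d n)"
        by (auto simp: indicator_def abs_mult right_diff_distrib[symmetric])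
    qed
    finally show "norm ((LINT \<theta>:\<Theta>|lborel. k \<theta> * p n \<theta>) - (LINT \<theta>:\<Theta>|lborel. k \<theta> * q \<theta>))
        \<le> ?K * ?d n" by simp
  qed
  then show ?thesis by (rule LIM_zero_cancel)
qed

lemma posterior_expectation_eq:
  "posterior_expectation \<Theta> f p x g =
     (LINT \<theta>:\<Theta>|lborel. g \<theta> * (f x \<theta> * p \<theta>)) / (LINT \<theta>:\<Theta>|lborel. f x \<theta> * p \<theta>)"
  by (simp add: posterior_expectation_def posterior_density_def)

section \<open>Likelihood, marginal and posterior regret\<close>

context exp_family
begin

text \<open>The hypothesis controls \<open>f x\<close> wherever \<open>H\<close> is bounded away
  from 0, hence to the left of any \<open>a\<close> in \<Theta>. Either \<open>H \<ge> r x\<close>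
  throughout, and this suffices, or \<open>H a < r x\<close> for some \<open>a\<close>, and an
  exponential tail takes over beyond \<open>a\<close>. The result lets the marginal converge along
  with the prior.\<close>

lemma set_integrable_likelihood:
  assumes x: "x \<in> S" and Hf: "set_integrable lborel \<Theta> (\<lambda>\<theta>. \<bar>H \<theta>\<bar> * f x \<theta>)"
  shows "set_integrable lborel \<Theta> (f x)"
proof -
  have meas: "set_borel_measurable lborel \<Theta> (f x)"
  proof -
    have "continuous_on \<Theta> (\<lambda>\<theta>. \<beta> \<theta> * t x * exp (- \<theta> * r x))"
      by (intro continuous_intros continuous_on_\<beta>)
    then have "continuous_on \<Theta> (f x)"
      by (rule continuous_on_cong[THEN iffD1, rotated -1]) (auto simp: density_eq x)
    then show ?thesis
      unfolding set_borel_measurable_def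
      using borel_measurable_continuous_on_indicator[OF parameter_set, of "f x"] by simp
  qed
  have bound: "f x \<theta> \<le> \<bar>H \<theta>\<bar> * f x \<theta> / h" if "\<theta> \<in> \<Theta>" "0 < h" "h \<le> H \<theta>" for \<theta> h
    using that f_pos[OF x that(1)] by (simp add: pos_le_divide_eq)
  show ?thesis
  proof (cases "\<exists>a\<in>\<Theta>. H a < r x")
    case False
    have "set_integrable lborel \<Theta> (\<lambda>\<theta>. \<bar>H \<theta>\<bar> * f x \<theta> / r x)"
      using Hf by (rule set_integrable_divide)
    then show ?thesis
      by (rule set_integrable_bound[OF _ meas])
         (use False bound[OF _ r_pos[OF x]] f_pos[OF x] r_pos[OF x] in
           \<open>auto simp: not_less less_imp_le\<close>)
  next
    case True
    then obtain a where a: "a \<in> \<Theta>" "H a < r x" by blast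
    define k where "k = r x - H a"
    have k: "0 < k" using a by (simp add: k_def)
    \<comment> \<open>Since \<open>ln \<beta>\<close> lies below its tangent at \<open>a\<close>, the likelihood decays exponentially beyond \<open>a\<close>.\<close>
    have tail: "f x \<theta> \<le> f x a * exp (k * a) * exp (- k * \<theta>)" if "\<theta> \<in> \<Theta>" for \<theta>
    proof -
      have "\<beta> \<theta> / \<beta> a \<le> exp ((\<theta> - a) * H a)"
        using ln_\<beta>_ratio_le[OF a(1) that] \<beta>_ratio_pos[OF a(1) that] by (metis exp_le_cancel_iff exp_ln)
      then have "\<beta> \<theta> / \<beta> a * (f x a * exp (- (\<theta> - a) * r x))
          \<le> exp ((\<theta> - a) * H a) * (f x a * exp (- (\<theta> - a) * r x))"
        using f_pos[OF x a(1)] by (intro mult_right_mono) auto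
      also have "\<dots> = f x a * (exp ((\<theta> - a) * H a) * exp (- (\<theta> - a) * r x))"
        by simp
      also have "exp ((\<theta> - a) * H a) * exp (- (\<theta> - a) * r x) = exp (k * a) * exp (- k * \<theta>)"
        by (simp add: k_def algebra_simps flip: exp_add)
      finally show ?thesis using f_tilt[OF x a(1) that] by (simp add: mult.assoc)
    qed
    let ?g = "\<lambda>\<theta>. f x a * exp (k * a) * exp (- k * \<theta>)"
    have "set_integrable lborel {a..} ?g"
      by (rule set_integrable_mult_right) (use set_integrable_exp_decay[OF k] in simp)
    then have "set_integrable lborel UNIV (\<lambda>\<theta>. indicat_real {a..} \<theta> * ?g \<theta>)"
      by (simp add: set_integrable_def)
    then have "set_integrable lborel \<Theta> (\<lambda>\<theta>. indicat_real {a..} \<theta> * ?g \<theta>)"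
      by (rule set_integrable_subset) (use parameter_set in auto)
    moreover have "set_integrable lborel \<Theta> (\<lambda>\<theta>. \<bar>H \<theta>\<bar> * f x \<theta> / H a)"
      using Hf by (rule set_integrable_divide)
    ultimately have "set_integrable lborel \<Theta>
        (\<lambda>\<theta>. indicat_real {a..} \<theta> * ?g \<theta> + \<bar>H \<theta>\<bar> * f x \<theta> / H a)"
      by (rule set_integral_add)
    then show ?thesis
    proof (rule set_integrable_bound[OF _ meas], intro AE_I2 impI)
      fix \<theta> assume \<theta>: "\<theta> \<in> \<Theta>"
      have nn: "0 \<le> \<bar>H \<theta>\<bar> * f x \<theta> / H a"
        using H_pos[OF a(1)] f_pos[OF x \<theta>] by simp
      have "f x \<theta> \<le> indicat_real {a..} \<theta> * ?g \<theta> + \<bar>H \<theta>\<bar> * f x \<theta> / H a"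
      proof (cases "a \<le> \<theta>")
        case True
        then show ?thesis using tail[OF \<theta>] nn by simp
      next
        case False
        then have "H a \<le> H \<theta>" using H_strict[OF \<theta> a(1)] by simp
        then show ?thesis using False bound[OF \<theta> H_pos[OF a(1)]] by simp
      qed
      then show "norm (f x \<theta>)
          \<le> norm (indicat_real {a..} \<theta> * ?g \<theta> + \<bar>H \<theta>\<bar> * f x \<theta> / H a)"
        using f_pos[OF x \<theta>] by simp
    qed
  qed
qed

text \<open>The likelihood is positive on \<Theta>, so a vanishing marginal would make the prior
  vanish almost everywhere, against its total mass 1.\<close>

lemma marginal_pos:
  assumes x: "x \<in> S" and p: "prior_density \<Theta> p"
    and int: "set_integrable lborel \<Theta> (\<lambda>\<theta>. f x \<theta> * p \<theta>)"
  shows "0 < (LINT \<theta>:\<Theta>|lborel. f x \<theta> * p \<theta>)"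
  unfolding set_lebesgue_integral_def
proof (rule integral_pos_if_not_AE_zero)
  show "integrable lborel (\<lambda>\<theta>. indicat_real \<Theta> \<theta> *\<^sub>R (f x \<theta> * p \<theta>))"
    using int by (simp add: set_integrable_def)
  show "0 \<le> indicat_real \<Theta> \<theta> *\<^sub>R (f x \<theta> * p \<theta>)" for \<theta>
    using p f_pos[OF x, of \<theta>] by (auto simp: indicator_def prior_density_def)
  show "\<not> (AE \<theta> in lborel. indicat_real \<Theta> \<theta> *\<^sub>R (f x \<theta> * p \<theta>) = 0)"
  proof
    assume "AE \<theta> in lborel. indicat_real \<Theta> \<theta> *\<^sub>R (f x \<theta> * p \<theta>) = 0"
    then have "AE \<theta> in lborel. ennreal (p \<theta>) * indicator \<Theta> \<theta> = 0"
      by (rule AE_mp) (use f_pos[OF x] in \<open>force simp: indicator_def intro!: AE_I2\<close>)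
    then have "(\<integral>\<^sup>+ \<theta>\<in>\<Theta>. ennreal (p \<theta>) \<partial>lborel) = (\<integral>\<^sup>+ \<theta>. 0 \<partial>(lborel :: real measure))"
      by (intro nn_integral_cong_AE)
    then show False using p by (simp add: prior_density_def)
  qed
qed

lemma bayes_estimator_in:
  assumes "bayes_estimator_defined \<Theta> f H p x"
  shows "bayes_estimator \<Theta> f H p x \<in> \<Theta>"
  using assms inj_on_H unfolding bayes_estimator_def bayes_estimator_defined_def
  by (auto intro: the_inv_into_into)

lemma H_bayes_estimator:
  assumes "bayes_estimator_defined \<Theta> f H p x"
  shows "H (bayes_estimator \<Theta> f H p x) = posterior_expectation \<Theta> f p x H"
  using assms inj_on_H unfolding bayes_estimator_def bayes_estimator_defined_def
  by (auto intro: f_the_inv_into_f)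

lemma posterior_expectation_tendsto:
  assumes x: "x \<in> S" and Hf: "set_integrable lborel \<Theta> (\<lambda>\<theta>. \<bar>H \<theta>\<bar> * f x \<theta>)"
    and p: "\<And>n. has_posterior_expectation \<Theta> f (p n) x H"
    and q: "prior_density \<Theta> q" "has_posterior_expectation \<Theta> f q x H"
    and lim: "(\<lambda>n. sup_distance \<Theta> (p n) q) \<longlonglongrightarrow> 0"
  shows "(\<lambda>n. posterior_expectation \<Theta> f (p n) x H) \<longlonglongrightarrow> posterior_expectation \<Theta> f q x H"
  unfolding posterior_expectation_eq
proof (rule tendsto_divide)
  show "(\<lambda>n. LINT \<theta>:\<Theta>|lborel. f x \<theta> * p n \<theta>) \<longlonglongrightarrow> (LINT \<theta>:\<Theta>|lborel. f x \<theta> * q \<theta>)"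
    using p q(2) set_integrable_abs[OF set_integrable_likelihood[OF x Hf]]
    by (intro set_integral_tendsto_sup_distance lim) (auto simp: has_posterior_expectation_def)
  have "set_integrable lborel \<Theta> (\<lambda>\<theta>. \<bar>H \<theta> * f x \<theta>\<bar>)"
    using Hf by (rule set_integrable_cong[THEN iffD1, OF refl refl, rotated])
      (simp add: abs_mult f_pos[OF x, THEN less_imp_le])
  then have "(\<lambda>n. LINT \<theta>:\<Theta>|lborel. (H \<theta> * f x \<theta>) * p n \<theta>)
      \<longlonglongrightarrow> (LINT \<theta>:\<Theta>|lborel. (H \<theta> * f x \<theta>) * q \<theta>)"
    using p q(2)
    by (intro set_integral_tendsto_sup_distance lim)
       (auto simp: has_posterior_expectation_def mult.assoc)
  then show "(\<lambda>n. LINT \<theta>:\<Theta>|lborel. H \<theta> * (f x \<theta> * p n \<theta>))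
      \<longlonglongrightarrow> (LINT \<theta>:\<Theta>|lborel. H \<theta> * (f x \<theta> * q \<theta>))"
    by (simp add: mult.assoc)
  show "(LINT \<theta>:\<Theta>|lborel. f x \<theta> * q \<theta>) \<noteq> 0"
    using marginal_pos[OF x q(1)] q(2) by (auto simp: has_posterior_expectation_def)
qed

text \<open>The difference depends on \<open>a\<close> only through \<open>H a\<close>, and
  affinely, so its posterior mean involves nothing but \<open>E(H | x)\<close>.\<close>

lemma intrinsic_loss_diff:
  assumes "a \<in> \<Theta>" "d \<in> \<Theta>" "e \<in> \<Theta>"
  shows "intrinsic_loss \<beta> H a d - intrinsic_loss \<beta> H a e = ln (\<beta> e / \<beta> d) + (d - e) * H a"
  using ln_\<beta>_ratio_trans[of d e a] assms by (simp add: intrinsic_loss_def algebra_simps)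

text \<open>Averaging the loss difference replaces \<open>H \<theta>\<close> by its posterior
  expectation, which is \<open>H\<close> at the Bayes estimate. Assumption \<open>L\<close> makes
  each of the two subtracted risks a genuine integral.\<close>

lemma posterior_regret_eq:
  assumes x: "x \<in> S" and p: "prior_density \<Theta> p" "bayes_estimator_defined \<Theta> f H p x"
    and L: "\<And>d. d \<in> \<Theta> \<Longrightarrow> has_posterior_expectation \<Theta> f p x (\<lambda>\<theta>. intrinsic_loss \<beta> H \<theta> d)"
    and d: "d \<in> \<Theta>"
  shows "posterior_regret \<Theta> \<beta> H f p x d = intrinsic_loss \<beta> H (bayes_estimator \<Theta> f H p x) d"
proof -
  let ?e = "bayes_estimator \<Theta> f H p x"
  have e: "?e \<in> \<Theta>" by (rule bayes_estimator_in[OF p(2)])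
  let ?I = "\<lambda>g. LINT \<theta>:\<Theta>|lborel. g \<theta> * (f x \<theta> * p \<theta>)"
  let ?m = "LINT \<theta>:\<Theta>|lborel. f x \<theta> * p \<theta>"
  let ?c = "ln (\<beta> ?e / \<beta> d)"
  have int: "set_integrable lborel \<Theta> (\<lambda>\<theta>. f x \<theta> * p \<theta>)"
    "set_integrable lborel \<Theta> (\<lambda>\<theta>. H \<theta> * (f x \<theta> * p \<theta>))"
    using p(2) by (auto simp: bayes_estimator_defined_def has_posterior_expectation_def)
  have m: "0 < ?m" by (rule marginal_pos[OF x p(1) int(1)])
  have "?I (\<lambda>\<theta>. intrinsic_loss \<beta> H \<theta> d) - ?I (\<lambda>\<theta>. intrinsic_loss \<beta> H \<theta> ?e)
      = (LINT \<theta>:\<Theta>|lborel. intrinsic_loss \<beta> H \<theta> d * (f x \<theta> * p \<theta>)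
          - intrinsic_loss \<beta> H \<theta> ?e * (f x \<theta> * p \<theta>))"
    using L[OF d] L[OF e]
    by (intro set_integral_diff(2)[symmetric]) (auto simp: has_posterior_expectation_def)
  also have "\<dots> = (LINT \<theta>:\<Theta>|lborel. ?c * (f x \<theta> * p \<theta>) + (d - ?e) * (H \<theta> * (f x \<theta> * p \<theta>)))"
  proof (rule set_lebesgue_integral_cong)
    show "\<Theta> \<in> sets lborel" using parameter_set by simp
    show "\<forall>\<theta>. \<theta> \<in> \<Theta> \<longrightarrow> intrinsic_loss \<beta> H \<theta> d * (f x \<theta> * p \<theta>)
          - intrinsic_loss \<beta> H \<theta> ?e * (f x \<theta> * p \<theta>)
        = ?c * (f x \<theta> * p \<theta>) + (d - ?e) * (H \<theta> * (f x \<theta> * p \<theta>))"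
      by (simp add: left_diff_distrib[symmetric] intrinsic_loss_diff d e) (simp add: algebra_simps)
  qed
  also have "\<dots> = ?c * ?m + (d - ?e) * ?I H"
    using set_integral_add(2)[OF set_integrable_mult_right[OF int(1), of ?c]
        set_integrable_mult_right[OF int(2), of "d - ?e"]] by simp
  finally have "posterior_regret \<Theta> \<beta> H f p x d = (?c * ?m + (d - ?e) * ?I H) / ?m"
    by (simp add: posterior_regret_def posterior_risk_def posterior_expectation_eq diff_divide_distrib[symmetric])
  also have "\<dots> = ?c + (d - ?e) * posterior_expectation \<Theta> f p x H"
    using m by (simp add: posterior_expectation_eq add_divide_distrib)
  also have "\<dots> = intrinsic_loss \<beta> H ?e d"
    by (simp add: intrinsic_loss_def H_bayes_estimator[OF p(2)])
  finally show ?thesis .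
qed

section \<open>Shape of the intrinsic loss and location of the PRGM formula\<close>

lemma intrinsic_loss_less_right:
  assumes "a \<in> \<Theta>" "d \<in> \<Theta>" "e \<in> \<Theta>" "a \<le> d" "d < e"
  shows "intrinsic_loss \<beta> H a d < intrinsic_loss \<beta> H a e"
proof -
  \<comment> \<open>By the tangent inequality at \<open>d\<close>, the loss grows from
    \<open>d\<close> to \<open>e\<close> by more than \<open>(e - d) * (H a - H d)\<close>.\<close>
  have "(e - d) * H d \<le> (e - d) * H a"
    using H_strict[of a d] assms by (intro mult_left_mono) (auto simp: le_less)
  then show ?thesis
    using intrinsic_loss_diff[OF assms(1,3,2)] ln_\<beta>_ratio_less[OF assms(2,3)]
      ln_\<beta>_ratio_swap[OF assms(2,3)] assms(4,5) by linarith
qed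

lemma intrinsic_loss_less_left:
  assumes "a \<in> \<Theta>" "d \<in> \<Theta>" "e \<in> \<Theta>" "e < d" "d \<le> a"
  shows "intrinsic_loss \<beta> H a d < intrinsic_loss \<beta> H a e"
proof -
  have "(e - d) * H d \<le> (e - d) * H a"
    using H_strict[of d a] assms by (intro mult_left_mono_neg) (auto simp: le_less)
  then show ?thesis
    using intrinsic_loss_diff[OF assms(1,3,2)] ln_\<beta>_ratio_less[OF assms(2,3)]
      ln_\<beta>_ratio_swap[OF assms(2,3)] assms(4,5) by linarith
qed

lemma intrinsic_loss_le_max:
  assumes "lo \<in> \<Theta>" "hi \<in> \<Theta>" "a \<in> \<Theta>" "d \<in> \<Theta>" "lo \<le> a" "a \<le> hi"
  shows "intrinsic_loss \<beta> H a d \<le> max (intrinsic_loss \<beta> H lo d) (intrinsic_loss \<beta> H hi d)"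
proof -
  \<comment> \<open>The three-point identity of Bregman divergences: the loss from \<open>b\<close>
    to \<open>d\<close> exceeds that from \<open>a\<close> to \<open>d\<close> by the loss from
    \<open>b\<close> to \<open>a\<close> plus the product assumed nonnegative. That product is
    nonnegative when \<open>a\<close> lies between \<open>b\<close> and \<open>d\<close>.\<close>
  have *: "intrinsic_loss \<beta> H a d \<le> intrinsic_loss \<beta> H b d"
    if "b \<in> \<Theta>" "0 \<le> (d - a) * (H b - H a)" for b
  proof -
    have "intrinsic_loss \<beta> H b d - intrinsic_loss \<beta> H a d
        = (a - b) * H b - ln (\<beta> a / \<beta> b) + (d - a) * (H b - H a)"
      using ln_\<beta>_ratio_trans[of d a b] ln_\<beta>_ratio_swap[of b a] assms that(1)
      by (simp add: intrinsic_loss_def algebra_simps)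
    then show ?thesis using that ln_\<beta>_ratio_le[OF that(1) assms(3)] by simp
  qed
  show ?thesis
  proof (cases "a \<le> d")
    case True
    then show ?thesis
      using *[OF assms(1)] H_strict[of lo a] assms by (cases "lo = a") auto
  next
    case False
    then show ?thesis
      using *[OF assms(2)] H_strict[of a hi] assms
      by (cases "hi = a") (auto simp: mult_nonpos_nonpos le_max_iff_disj)
  qed
qed

text \<open>Clearing the negative denominator reduces the lower bound to the tangent inequality at
  \<open>hi\<close> and the upper bound to the one at \<open>lo\<close>.\<close>

lemma PRGM_formula_strictly_between:
  assumes "lo \<in> \<Theta>" "hi \<in> \<Theta>" "lo < hi"
  shows "lo < PRGM_formula \<beta> H lo hi" "PRGM_formula \<beta> H lo hi < hi"
proof -
  have neg: "H hi - H lo < 0" using H_strict assms by simp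
  have "(hi - lo) * H hi < ln (\<beta> hi / \<beta> lo)" "ln (\<beta> hi / \<beta> lo) < (hi - lo) * H lo"
    using ln_\<beta>_ratio_less[of lo hi] ln_\<beta>_ratio_less[of hi lo] ln_\<beta>_ratio_swap[of lo hi] assms
    by (auto simp: algebra_simps)
  then show "lo < PRGM_formula \<beta> H lo hi" "PRGM_formula \<beta> H lo hi < hi"
    using assms neg by (auto simp: PRGM_formula_def neg_less_divide_eq neg_divide_less_eq algebra_simps)
qed

lemma intrinsic_loss_PRGM_formula:
  assumes "lo \<in> \<Theta>" "hi \<in> \<Theta>" "lo \<le> hi" "PRGM_formula \<beta> H lo hi \<in> \<Theta>"
  shows "intrinsic_loss \<beta> H lo (PRGM_formula \<beta> H lo hi) = intrinsic_loss \<beta> H hi (PRGM_formula \<beta> H lo hi)"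
proof (cases "lo = hi")
  case False
  define d where "d = PRGM_formula \<beta> H lo hi"
  have "H hi - H lo \<noteq> 0" using H_strict[of lo hi] False assms by simp
  then have "d * (H hi - H lo) = hi * H hi - lo * H lo - ln (\<beta> hi / \<beta> lo)"
    using False by (simp add: d_def PRGM_formula_def)
  moreover have "ln (\<beta> hi / \<beta> d) = ln (\<beta> hi / \<beta> lo) + ln (\<beta> lo / \<beta> d)"
    using ln_\<beta>_ratio_trans[of d lo hi] assms by (simp add: d_def)
  ultimately show ?thesis
    unfolding d_def[symmetric] by (simp add: intrinsic_loss_def algebra_simps)
qed simp

text \<open>Continuity in the parameter, not in the estimate: it carries bounds from the Bayes
  estimates to their infimum and supremum, which may not be attained.\<close>

lemma continuous_on_intrinsic_loss:
  assumes "{lo..hi} \<subseteq> \<Theta>" "lo \<le> hi" "d \<in> \<Theta>"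
  shows "continuous_on {lo..hi} (\<lambda>a. intrinsic_loss \<beta> H a d)"
proof -
  have "continuous_on {lo..hi} \<beta>" "continuous_on {lo..hi} H"
    using assms(1,2) by (auto intro!: continuous_on_subset[OF continuous_on_\<beta>]
        continuous_on_subset[OF continuous_on_H[of lo]])
  moreover have "\<beta> a / \<beta> d \<noteq> 0" if "a \<in> {lo..hi}" for a
    using \<beta>_ratio_pos[of d a] assms that by auto
  ultimately show ?thesis
    unfolding intrinsic_loss_def
    using \<beta>_nonzero[OF assms(3)] by (intro continuous_intros) auto
qed

end

section \<open>Connected classes of priors and the minimax estimate\<close>

lemma connected_image_of_sequentially_continuous:
  fixes \<Lambda> :: "'a::first_countable_topology set" and g :: "'a \<Rightarrow> real"
  assumes "connected \<Lambda>"
    and seq: "\<And>u a. (\<And>n. u n \<in> \<Lambda>) \<Longrightarrow> a \<in> \<Lambda> \<Longrightarrow> u \<longlonglongrightarrow> a \<Longrightarrow> (\<lambda>n. g (u n)) \<longlonglongrightarrow> g a"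
  shows "connected (g ` \<Lambda>)"
proof (rule connected_continuous_image[OF _ assms(1)])
  show "continuous_on \<Lambda> g"
    unfolding continuous_on_def
  proof (intro ballI topological_tendstoI)
    fix a T assume "a \<in> \<Lambda>" "open T" "g a \<in> T"
    \<comment> \<open>First countability of the index space turns the condition on sequences into
      continuity.\<close>
    then have "\<forall>\<^sub>F z in inf (nhds a) (principal \<Lambda>). g z \<in> T"
      by (intro sequentially_imp_eventually_nhds_within) (use seq topological_tendstoD in blast)
    then show "\<forall>\<^sub>F z in at a within \<Lambda>. g z \<in> T"
      by (auto simp: eventually_at_filter eventually_inf_principal elim: eventually_mono)
  qed
qed

theorem theorem4:
  fixes S \<Theta> :: "real set" and M :: "real measure"
    and \<beta> \<beta>' t r H :: "real \<Rightarrow> real" and f :: "real \<Rightarrow> real \<Rightarrow> real"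
    and \<Lambda> :: "'a::first_countable_topology set"
    and \<pi> :: "'a \<Rightarrow> real \<Rightarrow> real"
    and \<Gamma> :: "(real \<Rightarrow> real) set"
    and x :: real
  assumes "exp_family S \<Theta> M \<beta> \<beta>' t r f H"
    and "x \<in> S"
    and "connected \<Lambda>" and "\<Lambda> \<noteq> {}"
    and "\<Gamma> = \<pi> ` \<Lambda>"
    and "\<And>p. p \<in> \<Gamma> \<Longrightarrow> prior_density \<Theta> p"
    and "set_integrable lborel \<Theta> (\<lambda>\<theta>. \<bar>H \<theta>\<bar> * f x \<theta>)"
    and "\<And>\<alpha> a. (\<And>n. \<alpha> n \<in> \<Lambda>) \<Longrightarrow> a \<in> \<Lambda> \<Longrightarrow> \<alpha> \<longlonglongrightarrow> a \<Longrightarrow>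
           (\<lambda>n. sup_distance \<Theta> (\<pi> (\<alpha> n)) (\<pi> a)) \<longlonglongrightarrow> 0"
    and "\<And>p. p \<in> \<Gamma> \<Longrightarrow> bayes_estimator_defined \<Theta> f H p x"
    and "bdd_below ((\<lambda>p. bayes_estimator \<Theta> f H p x) ` \<Gamma>)"
    and "bdd_above ((\<lambda>p. bayes_estimator \<Theta> f H p x) ` \<Gamma>)"
    and "lower_bayes \<Theta> f H \<Gamma> x \<in> \<Theta>"
    and "upper_bayes \<Theta> f H \<Gamma> x \<in> \<Theta>"
  shows "(\<exists>p\<in>\<Gamma>. delta_PR \<Theta> \<beta> H f \<Gamma> x = bayes_estimator \<Theta> f H p x) \<and>
         ((\<forall>p\<in>\<Gamma>. \<forall>d\<in>\<Theta>. has_posterior_expectation \<Theta> f p x (\<lambda>\<theta>. intrinsic_loss \<beta> H \<theta> d)) \<longrightarrow>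
          (\<forall>d. is_PRGM \<Theta> \<beta> H f \<Gamma> x d \<longleftrightarrow> d = delta_PR \<Theta> \<beta> H f \<Gamma> x))"
proof -
  interpret exp_family S \<Theta> M \<beta> \<beta>' t r f H by (rule assms(1))
  note x = assms(2) and prior = assms(6) and defd = assms(9)
  let ?\<delta> = "\<lambda>p. bayes_estimator \<Theta> f H p x"
  define D where "D = ?\<delta> ` \<Gamma>"
  define lo where "lo = lower_bayes \<Theta> f H \<Gamma> x"
  define hi where "hi = upper_bayes \<Theta> f H \<Gamma> x"
  define d0 where "d0 = delta_PR \<Theta> \<beta> H f \<Gamma> x"
  have d0_eq: "d0 = PRGM_formula \<beta> H lo hi"
    by (simp add: d0_def lo_def hi_def delta_PR_def)
  have lo: "lo \<in> \<Theta>" and hi: "hi \<in> \<Theta>" using assms(12,13) by (auto simp: lo_def hi_def)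
  have D_ne: "D \<noteq> {}" using assms(4,5) by (simp add: D_def)
  have D_sub: "D \<subseteq> \<Theta>" using bayes_estimator_in[OF defd] by (auto simp: D_def)
  have bdd: "bdd_below D" "bdd_above D" using assms(10,11) by (auto simp: D_def)
  have lo_eq: "lo = Inf D" and hi_eq: "hi = Sup D"
    by (auto simp: lo_def hi_def D_def lower_bayes_def upper_bayes_def)
  have D_bounds: "D \<subseteq> {lo..hi}"
    using bdd by (auto simp: lo_eq hi_eq cInf_lower cSup_upper)
  then have lo_hi: "lo \<le> hi" using D_ne by auto

  \<comment> \<open>Connectedness is proved for the posterior expectations, on which convergence of
    priors acts directly. It passes to \<open>D\<close> through \<open>H\<close> followed by its
    order properties, without continuity of the inverse of \<open>H\<close>.\<close>
  have "connected ((\<lambda>\<alpha>. posterior_expectation \<Theta> f (\<pi> \<alpha>) x H) ` \<Lambda>)"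
    using assms(3)
  proof (rule connected_image_of_sequentially_continuous)
    fix u a assume u: "\<And>n. u n \<in> \<Lambda>" "a \<in> \<Lambda>" "u \<longlonglongrightarrow> a"
    show "(\<lambda>n. posterior_expectation \<Theta> f (\<pi> (u n)) x H) \<longlonglongrightarrow> posterior_expectation \<Theta> f (\<pi> a) x H"
      using u(1,2) defd prior assms(5)
      by (intro posterior_expectation_tendsto[OF x assms(7)] assms(8)[OF u])
         (auto simp: bayes_estimator_defined_def)
  qed
  also have "(\<lambda>\<alpha>. posterior_expectation \<Theta> f (\<pi> \<alpha>) x H) ` \<Lambda> = H ` D"
    unfolding D_def assms(5) image_image
    by (rule image_cong) (use H_bayes_estimator[OF defd] assms(5) in auto)
  finally have D_interval: "is_interval D"
    by (intro is_interval_if_is_interval_H_image[OF D_sub]) (simp add: is_interval_connected_1)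
  have between: "c \<in> D" if c: "lo < c" "c < hi" for c
  proof -
    obtain a b where "a \<in> D" "a < c" "b \<in> D" "c < b"
      using cInf_lessD[OF D_ne] less_cSupD[OF D_ne] c by (metis lo_eq hi_eq)
    then show ?thesis using D_interval unfolding is_interval_1 by (meson less_imp_le)
  qed
  \<comment> \<open>\<Theta> has no gap here: interior points are Bayes estimates, and the endpoints
    lie in \<Theta> by hypothesis.\<close>
  have lo_hi_sub: "{lo..hi} \<subseteq> \<Theta>"
    using between D_sub lo hi by (force simp: le_less)
  have d0_bounds: "lo \<le> d0" "d0 \<le> hi"
    using PRGM_formula_strictly_between[OF lo hi] lo_hi
    by (cases "lo = hi"; force simp: d0_eq PRGM_formula_def)+
  \<comment> \<open>If \<open>lo = hi\<close>, then \<open>D\<close> is a singleton and the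
    convention in the formula picks its element.\<close>
  have d0_D: "d0 \<in> D"
  proof (cases "lo = hi")
    case True
    then show ?thesis using d0_bounds D_bounds D_ne by auto
  next
    case False
    then show ?thesis
      using PRGM_formula_strictly_between[OF lo hi] lo_hi by (intro between) (auto simp: d0_eq)
  qed
  then have d0: "d0 \<in> \<Theta>" using D_sub by auto

  have "is_PRGM \<Theta> \<beta> H f \<Gamma> x d \<longleftrightarrow> d = d0"
    if L: "\<forall>p\<in>\<Gamma>. \<forall>d\<in>\<Theta>. has_posterior_expectation \<Theta> f p x (\<lambda>\<theta>. intrinsic_loss \<beta> H \<theta> d)" for d
  proof -
    \<comment> \<open>The common loss at the crossing of the two tangents, which turns out to be the
      minimax regret.\<close>
    define m where "m = intrinsic_loss \<beta> H lo d0"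
    have m_hi: "m = intrinsic_loss \<beta> H hi d0"
      unfolding m_def d0_eq
      by (rule intrinsic_loss_PRGM_formula[OF lo hi lo_hi]) (use d0 d0_eq in simp)
    define R where "R = (\<lambda>d. SUP p\<in>\<Gamma>. ereal (posterior_regret \<Theta> \<beta> H f p x d))"
    have R_eq: "R d = (SUP a\<in>D. ereal (intrinsic_loss \<beta> H a d))" if "d \<in> \<Theta>" for d
    proof -
      have "posterior_regret \<Theta> \<beta> H f p x d = intrinsic_loss \<beta> H (?\<delta> p) d" if "p \<in> \<Gamma>" for p
        using posterior_regret_eq[OF x prior[OF that] defd[OF that] _ \<open>d \<in> \<Theta>\<close>] L that by blast
      then show ?thesis unfolding R_def D_def image_image by (intro SUP_cong) auto
    qed
    have R_d0: "R d0 \<le> ereal m"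
      unfolding R_eq[OF d0]
    proof (rule SUP_least)
      fix a assume "a \<in> D"
      then have "a \<in> \<Theta>" "lo \<le> a" "a \<le> hi" using D_sub D_bounds by auto
      then show "ereal (intrinsic_loss \<beta> H a d0) \<le> ereal m"
        using intrinsic_loss_le_max[OF lo hi _ d0, of a] m_hi m_def by auto
    qed
    \<comment> \<open>\<open>lo\<close> and \<open>hi\<close> need not belong to \<open>D\<close>. A
      real \<open>v\<close> strictly between bounds the loss on \<open>D\<close>, hence by
      continuity on its closure, which contains both.\<close>
    have R_ge: "ereal (intrinsic_loss \<beta> H e d) \<le> R d" if e: "e = lo \<or> e = hi" and d: "d \<in> \<Theta>" for e d
    proof (rule ccontr)
      assume "\<not> ?thesis"
      then have less: "R d < ereal (intrinsic_loss \<beta> H e d)" by simp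
      then obtain v where v: "R d < ereal v" "v < intrinsic_loss \<beta> H e d"
        by (metis ereal_dense2 less_ereal.simps(1))
      have "closure D \<subseteq> {lo..hi}" by (rule closure_minimal[OF D_bounds]) simp
      then have "continuous_on (closure D) (\<lambda>a. intrinsic_loss \<beta> H a d)"
        by (rule continuous_on_subset[OF continuous_on_intrinsic_loss[OF lo_hi_sub lo_hi d]])
      moreover have "e \<in> closure D"
        using e closure_contains_Inf[OF D_ne bdd(1)] closure_contains_Sup[OF D_ne bdd(2)]
        by (auto simp: lo_eq hi_eq)
      moreover have "intrinsic_loss \<beta> H a d \<le> v" if "a \<in> D" for a
      proof -
        have "ereal (intrinsic_loss \<beta> H a d) \<le> R d"
          unfolding R_eq[OF d] by (rule SUP_upper[OF that])
        also note v(1)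
        finally show ?thesis by simp
      qed
      ultimately have "intrinsic_loss \<beta> H e d \<le> v" by (rule continuous_le_on_closure)
      then show False using v(2) by simp
    qed
    \<comment> \<open>Moving right of \<open>d0\<close> raises the loss from \<open>lo\<close> above
      \<open>m\<close>, moving left raises the loss from \<open>hi\<close>; this also covers
      \<open>d\<close> outside \<open>{lo..hi}\<close> and makes the minimiser unique.\<close>
    have R_gt: "ereal m < R d" if d: "d \<in> \<Theta>" "d \<noteq> d0" for d
    proof (cases "d0 < d")
      case True
      then have "m < intrinsic_loss \<beta> H lo d"
        unfolding m_def by (intro intrinsic_loss_less_right lo d0 d d0_bounds)
      then show ?thesis
        using less_le_trans[OF _ R_ge[of lo d], of "ereal m"] d by simp
    next
      case False
      then have "m < intrinsic_loss \<beta> H hi d"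
        unfolding m_hi using d(2) by (intro intrinsic_loss_less_left hi d0 d d0_bounds) auto
      then show ?thesis
        using less_le_trans[OF _ R_ge[of hi d], of "ereal m"] d by simp
    qed
    have "is_PRGM \<Theta> \<beta> H f \<Gamma> x d \<longleftrightarrow> d \<in> \<Theta> \<and> (\<forall>d'\<in>\<Theta>. R d \<le> R d')"
      by (simp add: is_PRGM_def R_def)
    also have "\<dots> \<longleftrightarrow> d = d0"
    proof
      assume "d \<in> \<Theta> \<and> (\<forall>d'\<in>\<Theta>. R d \<le> R d')"
      then show "d = d0" using R_gt[of d] R_d0 d0 by (meson leD order_trans)
    next
      assume "d = d0"
      then show "d \<in> \<Theta> \<and> (\<forall>d'\<in>\<Theta>. R d \<le> R d')"
        using d0 R_d0 R_gt by (metis less_imp_le order_refl order_trans)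
    qed
    finally show ?thesis .
  qed
  moreover have "\<exists>p\<in>\<Gamma>. d0 = ?\<delta> p" using d0_D by (auto simp: D_def)
  ultimately show ?thesis unfolding d0_def by blast
qed

end
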